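(* Let $k\ge 3$ and let $f_1,f_2$ be two multisets on $\mathbb{Z}_2^{k-1}$ with distinguishing number $k$. Then there exists a bijective group homomorphism $\theta:\mathbb{Z}_2^{k-1}\to\mathbb{Z}_2^{k-1}$ such that $\theta f_1$ and $\theta f_2$ are in standard position, i.e. \[\widehat{\theta f_1}(e_1)\cdots\widehat{\theta f_1}(e_{k-1})\,\widehat{\theta f_1}(h)\ne\widehat{\theta f_2}(e_1)\cdots\widehat{\theta f_2}(e_{k-1})\,\widehat{\theta f_2}(h).\]
   Context: A multiset on $\mathbb{Z}_2^m$ is a function $\phi:\mathbb{Z}_2^m\to\mathbb{N}$. Its $i$-deck is $\mathrm{deck}_i\phi(s_1,\dots,s_i)=\sum_{g\in\mathbb{Z}_2^m}\phi(g+s_1)\cdots\phi(g+s_i)$. Two multisets are $k$-indistinguishable if their $i$-decks agree for all $i\le k$, and $k$-distinguishable otherwise; their distinguishing number is the smallest $k$ for which they are $k$-distinguishable. For a linear map $\theta$ and multiset $f$, $\theta f(x)=\sum_{z:\theta z=x}f(z)$. The Fourier transform of $f:\mathbb{Z}_2^{m}\to\mathbb{Z}$ is $\hat f(x)=\sum_{y}f(y)(-1)^{x_1y_1+\dots+x_my_m}$. Here $e_1,\dots,e_{k-1}$ is the standard basis of $\mathbb{Z}_2^{k-1}$ and $h=e_1+\dots+e_{k-1}$ is the all-ones vector. *)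

theory Defs
  imports "HOL-Analysis.Analysis" "HOL-Library.Z2"
begin

(* The group of m-tuples over the integers mod 2 is the type bit ^ 'n with CARD('n) = m. A multiset
   on it is a function into nat, its value at a point being the multiplicity. *)

instance bit :: finite
proof
  have "(UNIV :: bit set) \<subseteq> {0, 1}"
    by (auto intro: bit.exhaust)
  then show "finite (UNIV :: bit set)"
    by (rule finite_subset) simp
qed

(* The arguments s_1, ..., s_i are the values of a sequence s at the positions 1, ..., i;
   all other values of s are irrelevant. *)
definition deck :: "nat \<Rightarrow> (bit ^ 'n \<Rightarrow> nat) \<Rightarrow> (nat \<Rightarrow> bit ^ 'n) \<Rightarrow> nat" where
  "deck i \<phi> s = (\<Sum>g\<in>UNIV. \<Prod>j=1..i. \<phi> (g + s j))"

(* The case i = 0 imposes no condition: the 0-deck is the size of the group. *)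
definition indistinguishable :: "nat \<Rightarrow> (bit ^ 'n \<Rightarrow> nat) \<Rightarrow> (bit ^ 'n \<Rightarrow> nat) \<Rightarrow> bool" where
  "indistinguishable k \<phi> \<psi> \<longleftrightarrow> (\<forall>i\<le>k. deck i \<phi> = deck i \<psi>)"

abbreviation distinguishable :: "nat \<Rightarrow> (bit ^ 'n \<Rightarrow> nat) \<Rightarrow> (bit ^ 'n \<Rightarrow> nat) \<Rightarrow> bool" where
  "distinguishable k \<phi> \<psi> \<equiv> \<not> indistinguishable k \<phi> \<psi>"

(* A relation rather than a function, since multisets that are k-indistinguishable for all k
   have no distinguishing number. *)
definition has_distinguishing_number :: "(bit ^ 'n \<Rightarrow> nat) \<Rightarrow> (bit ^ 'n \<Rightarrow> nat) \<Rightarrow> nat \<Rightarrow> bool" where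
  "has_distinguishing_number \<phi> \<psi> k \<longleftrightarrow>
     distinguishable k \<phi> \<psi> \<and> (\<forall>j. distinguishable j \<phi> \<psi> \<longrightarrow> k \<le> j)"

definition push_forward ::
    "(bit ^ 'm \<Rightarrow> bit ^ 'n) \<Rightarrow> (bit ^ 'm \<Rightarrow> nat) \<Rightarrow> bit ^ 'n \<Rightarrow> nat" where
  "push_forward \<theta> f x = (\<Sum>z | \<theta> z = x. f z)"

definition fourier :: "(bit ^ 'n \<Rightarrow> int) \<Rightarrow> bit ^ 'n \<Rightarrow> int" where
  "fourier f x = (\<Sum>y\<in>UNIV. f y * (-1) ^ (\<Sum>i\<in>UNIV. of_bit (x $ i) * of_bit (y $ i)))"

definition all_ones :: "bit ^ 'n" where
  "all_ones = (\<Sum>i\<in>UNIV. axis i 1)"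

definition standard_position :: "(bit ^ 'n \<Rightarrow> nat) \<Rightarrow> (bit ^ 'n \<Rightarrow> nat) \<Rightarrow> bool" where
  "standard_position \<phi> \<psi> \<longleftrightarrow>
     (\<Prod>i\<in>UNIV. fourier (\<lambda>y. int (\<phi> y)) (axis i 1)) * fourier (\<lambda>y. int (\<phi> y)) all_ones \<noteq>
     (\<Prod>i\<in>UNIV. fourier (\<lambda>y. int (\<psi> y)) (axis i 1)) * fourier (\<lambda>y. int (\<psi> y)) all_ones"

end

theory Submission
  imports Defs
begin

text \<open>
  Taking Fourier transforms of the \<open>i\<close>-deck in all its arguments shows that two multisets have the
  same \<open>i\<close>-deck iff the products of their Fourier coefficients over \<open>x 1, \<dots>, x i\<close> agree whenever
  \<open>x 1 + \<dots> + x i = 0\<close>. Hence distinguishing number \<open>k\<close> yields \<open>x 1, \<dots>, x k\<close> with sum zero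
  and different products. No nonempty proper subfamily has sum zero, since
  otherwise the products over it and over its complement, being shorter, would agree.
  So \<open>x 1, \<dots>, x (k - 1)\<close> is a basis, and \<open>\<theta>\<close> can be taken to be the transpose of the
  linear map sending \<open>e i\<close> to \<open>x i\<close>, which then sends \<open>h\<close> to \<open>x k\<close>.
\<close>

section \<open>Characters of the group and their orthogonality\<close>

definition character :: "bit ^ 'n \<Rightarrow> bit ^ 'n \<Rightarrow> int" where
  "character x y = (-1) ^ (\<Sum>i\<in>UNIV. of_bit (x $ i) * of_bit (y $ i))"

lemma fourier_eq_sum_character: "fourier f x = (\<Sum>y\<in>UNIV. f y * character x y)"
  by (simp add: fourier_def character_def)

text \<open>The exponent in \<open>character\<close> is a natural number and depends additively on
  \<open>x\<close> only modulo 2. Writing the sign coordinate by coordinate turns bilinearity into a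
  finite case check.\<close>

lemma character_eq_prod:
  "character x y = (\<Prod>i\<in>UNIV. if x $ i = 1 \<and> y $ i = 1 then -1 else 1)"
  unfolding character_def power_sum
proof (rule prod.cong)
  fix i
  show "(-1) ^ (of_bit (x $ i) * of_bit (y $ i)) = (if x $ i = 1 \<and> y $ i = 1 then -1 else 1 :: int)"
    by (cases "x $ i"; cases "y $ i") simp_all
qed simp

lemma character_commute: "character x y = character y x"
  by (simp add: character_eq_prod conj_commute)

lemma character_0_left [simp]: "character 0 y = 1"
  by (simp add: character_eq_prod)

lemma character_add_left: "character (x + y) z = character x z * character y z"
  unfolding character_eq_prod prod.distrib [symmetric]
  by (rule prod.cong) auto

lemma character_add_right: "character z (x + y) = character z x * character z y"
  by (metis character_add_left character_commute)

lemma character_sum_left: "character (\<Sum>i\<in>A. x i) z = (\<Prod>i\<in>A. character (x i) z)"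
  by (induction A rule: infinite_finite_induct) (auto simp: character_add_left)

lemma character_axis: "character (axis i 1) y = (if y $ i = 1 then -1 else 1)"
proof -
  have "character (axis i 1) y = (\<Prod>j\<in>UNIV. if j = i then if y $ i = 1 then -1 else 1 else 1)"
    unfolding character_eq_prod by (rule prod.cong) (auto simp: axis_def)
  then show ?thesis by simp
qed

lemma character_cases: "character x y = 1 \<or> character x y = -1"
  by (simp add: character_def minus_one_power_iff)

lemma vec_bit_add_self [simp]: "x + x = (0 :: bit ^ 'n)"
  by (simp add: vec_eq_iff)

lemma vec_bit_eq_iff_add: "x = y \<longleftrightarrow> x + y = (0 :: bit ^ 'n)"
  by (metis add.assoc add_0 add_0_right vec_bit_add_self)

text \<open>If \<open>x\<close> has a coordinate \<open>i\<close> equal to 1, translation by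
  \<open>axis i 1\<close> permutes the group and flips the sign of the character, so the sum equals
  its own negative.\<close>

lemma sum_character:
  "(\<Sum>g\<in>UNIV. character x g) = (if x = (0 :: bit ^ 'n) then int CARD(bit ^ 'n) else 0)"
proof (cases "x = 0")
  case False
  then obtain i where "x $ i = 1"
    by (metis bit_not_zero_iff vec_eq_iff zero_index)
  then have flip: "character x (g + axis i 1) = - character x g" for g
    by (simp add: character_add_right character_commute [of x "axis i 1"] character_axis)
  have "(\<Sum>g\<in>UNIV. character x g) = (\<Sum>g\<in>UNIV. character x (g + axis i 1))"
    by (rule sum.reindex_bij_witness [of _ "\<lambda>g. g + axis i 1" "\<lambda>g. g + axis i 1"])
      (auto simp: add.assoc)
  also have "\<dots> = - (\<Sum>g\<in>UNIV. character x g)"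
    by (simp add: flip sum_negf)
  finally show ?thesis using False by simp
qed simp

section \<open>Fourier inversion and the Fourier form of decks\<close>

lemma fourier_inversion:
  fixes f :: "bit ^ 'n \<Rightarrow> int"
  shows "(\<Sum>x\<in>UNIV. fourier f x * character x y) = int CARD(bit ^ 'n) * f y"
proof -
  \<comment> \<open>Every element is its own inverse, so \<open>z + y\<close> plays the role of
    \<open>z - y\<close> and orthogonality isolates the term \<open>z = y\<close>.\<close>
  have "f z * character x z * character x y = f z * character (z + y) x" for x z
    by (simp add: character_commute [of "z + y" x] character_add_right)
  then have "(\<Sum>x\<in>UNIV. fourier f x * character x y)
      = (\<Sum>x\<in>UNIV. \<Sum>z\<in>UNIV. f z * character (z + y) x)"
    by (simp only: fourier_eq_sum_character sum_distrib_right)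
  also have "\<dots> = (\<Sum>z\<in>UNIV. f z * (\<Sum>x\<in>UNIV. character (z + y) x))"
    by (subst sum.swap) (simp add: sum_distrib_left)
  also have "\<dots> = (\<Sum>z\<in>UNIV. if z = y then int CARD(bit ^ 'n) * f z else 0)"
    by (rule sum.cong) (auto simp: sum_character simp flip: vec_bit_eq_iff_add)
  finally show ?thesis by simp
qed

lemma fourier_translate:
  "(\<Sum>s\<in>UNIV. f (g + s) * character x s) = fourier f x * character x g"
proof -
  have "(\<Sum>s\<in>UNIV. f (g + s) * character x s) = (\<Sum>y\<in>UNIV. f y * character x (y + g))"
    by (rule sum.reindex_bij_witness [of _ "\<lambda>s. g + s" "\<lambda>s. g + s"])
      (auto simp: add.commute [of _ g] simp flip: add.assoc)
  then show ?thesis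
    by (simp add: fourier_eq_sum_character character_add_right sum_distrib_right mult.assoc)
qed

text \<open>For fixed \<open>g\<close> the sum over tuples factors into one-variable sums, each of
  which is a translated transform. The leftover characters at \<open>g\<close> multiply to the
  character of the sum of the \<open>x j\<close>, which is 1, so the sum over \<open>g\<close> only
  counts the group. \<open>PiE\<close> keeps the set of tuples finite.\<close>

lemma fourier_deck:
  fixes \<phi> :: "bit ^ 'n \<Rightarrow> nat"
  assumes "(\<Sum>j=1..i. x j) = 0"
  shows "(\<Sum>s\<in>PiE {1..i} (\<lambda>_. UNIV). int (deck i \<phi> s) * (\<Prod>j=1..i. character (x j) (s j)))
       = int CARD(bit ^ 'n) * (\<Prod>j=1..i. fourier (\<lambda>y. int (\<phi> y)) (x j))"
proof -
  have "(\<Sum>s\<in>PiE {1..i} (\<lambda>_. UNIV). int (deck i \<phi> s) * (\<Prod>j=1..i. character (x j) (s j)))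
      = (\<Sum>s\<in>PiE {1..i} (\<lambda>_. UNIV). \<Sum>g\<in>UNIV. \<Prod>j=1..i. int (\<phi> (g + s j)) * character (x j) (s j))"
    by (simp add: deck_def sum_distrib_right prod.distrib)
  also have "\<dots> = (\<Sum>g\<in>UNIV. \<Prod>j=1..i. \<Sum>s\<in>UNIV. int (\<phi> (g + s)) * character (x j) s)"
    by (subst sum.swap) (simp add: prod_sum_PiE)
  also have "\<dots> = (\<Sum>g\<in>UNIV. \<Prod>j=1..i. fourier (\<lambda>y. int (\<phi> y)) (x j) * character (x j) g)"
    using fourier_translate [of "\<lambda>y. int (\<phi> y)"] by simp
  also have "\<dots> = int CARD(bit ^ 'n) * (\<Prod>j=1..i. fourier (\<lambda>y. int (\<phi> y)) (x j))"
    unfolding prod.distrib character_sum_left [symmetric] assms by simp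
  finally show ?thesis .
qed

text \<open>Inserting the inversion formula for each factor leaves a sum over \<open>g\<close> of
  the character of the sum of the \<open>x j\<close>; by orthogonality only tuples with sum zero
  survive. The power of the group order on the left keeps everything in the integers.\<close>

lemma deck_inversion:
  fixes \<phi> :: "bit ^ 'n \<Rightarrow> nat"
  shows "int CARD(bit ^ 'n) ^ i * int (deck i \<phi> s)
       = (\<Sum>x\<in>PiE {1..i} (\<lambda>_. UNIV). if (\<Sum>j=1..i. x j) = 0
            then int CARD(bit ^ 'n) * (\<Prod>j=1..i. fourier (\<lambda>y. int (\<phi> y)) (x j))
              * (\<Prod>j=1..i. character (x j) (s j)) else 0)"
proof -
  define F where "F = fourier (\<lambda>y. int (\<phi> y))"
  have "int CARD(bit ^ 'n) ^ i * int (deck i \<phi> s)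
      = (\<Sum>g\<in>UNIV. \<Prod>j=1..i. int CARD(bit ^ 'n) * int (\<phi> (g + s j)))"
    unfolding prod.distrib by (simp add: deck_def sum_distrib_left)
  also have "\<dots> = (\<Sum>g\<in>UNIV. \<Prod>j=1..i. \<Sum>x\<in>UNIV. F x * character x (g + s j))"
    unfolding F_def fourier_inversion ..
  also have "\<dots> = (\<Sum>x\<in>PiE {1..i} (\<lambda>_. UNIV). \<Sum>g\<in>UNIV. \<Prod>j=1..i. F (x j) * character (x j) (g + s j))"
    by (subst sum.swap) (simp add: prod_sum_PiE)
  also have "\<dots> = (\<Sum>x\<in>PiE {1..i} (\<lambda>_. UNIV). (\<Prod>j=1..i. F (x j)) * (\<Prod>j=1..i. character (x j) (s j))
                     * (\<Sum>g\<in>UNIV. character (\<Sum>j=1..i. x j) g))"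
    by (simp add: character_add_right prod.distrib character_sum_left sum_distrib_left mult_ac)
  also have "\<dots> = (\<Sum>x\<in>PiE {1..i} (\<lambda>_. UNIV). if (\<Sum>j=1..i. x j) = 0
            then int CARD(bit ^ 'n) * (\<Prod>j=1..i. F (x j))
              * (\<Prod>j=1..i. character (x j) (s j)) else 0)"
    by (rule sum.cong) (auto simp: sum_character)
  finally show ?thesis unfolding F_def .
qed

lemma deck_eq_iff_fourier:
  fixes \<phi> \<psi> :: "bit ^ 'n \<Rightarrow> nat"
  shows "deck i \<phi> = deck i \<psi> \<longleftrightarrow>
    (\<forall>x. (\<Sum>j=1..i. x j) = 0 \<longrightarrow> (\<Prod>j=1..i. fourier (\<lambda>y. int (\<phi> y)) (x j))
                                = (\<Prod>j=1..i. fourier (\<lambda>y. int (\<psi> y)) (x j)))"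
    (is "?L \<longleftrightarrow> ?R")
proof
  assume eq: ?L
  show ?R
  proof (intro allI impI)
    fix x :: "nat \<Rightarrow> bit ^ 'n"
    assume "(\<Sum>j=1..i. x j) = 0"
    then show "(\<Prod>j=1..i. fourier (\<lambda>y. int (\<phi> y)) (x j))
             = (\<Prod>j=1..i. fourier (\<lambda>y. int (\<psi> y)) (x j))"
      using fourier_deck [of x i \<phi>] fourier_deck [of x i \<psi>] eq by simp
  qed
next
  assume R: ?R
  show ?L
  proof
    fix s
    have "int CARD(bit ^ 'n) ^ i * int (deck i \<phi> s) = int CARD(bit ^ 'n) ^ i * int (deck i \<psi> s)"
      unfolding deck_inversion by (rule sum.cong) (simp_all add: R del: One_nat_def)
    then show "deck i \<phi> s = deck i \<psi> s" by simp
  qed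
qed

text \<open>Enumerating \<open>S\<close> carries the criterion from initial segments to arbitrary
  finite index sets, as needed for a subfamily and its complement.\<close>

lemma deck_eq_imp_prod_fourier_eq:
  fixes \<phi> \<psi> :: "bit ^ 'n \<Rightarrow> nat"
  assumes "deck (card S) \<phi> = deck (card S) \<psi>" "finite S" "(\<Sum>j\<in>S. x j) = 0"
  shows "(\<Prod>j\<in>S. fourier (\<lambda>y. int (\<phi> y)) (x j)) = (\<Prod>j\<in>S. fourier (\<lambda>y. int (\<psi> y)) (x j))"
proof -
  obtain b where b: "bij_betw b {1..card S} S"
    using ex_bij_betw_nat_finite_1 [OF \<open>finite S\<close>] by blast
  have "(\<Sum>j=1..card S. x (b j)) = 0"
    using sum.reindex_bij_betw [OF b, of x] assms(3) by simp
  then have "(\<Prod>j=1..card S. fourier (\<lambda>y. int (\<phi> y)) (x (b j)))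
           = (\<Prod>j=1..card S. fourier (\<lambda>y. int (\<psi> y)) (x (b j)))"
    using assms(1) unfolding deck_eq_iff_fourier by blast
  then show ?thesis
    using prod.reindex_bij_betw [OF b, of "\<lambda>j. fourier (\<lambda>y. int (\<phi> y)) (x j)"]
      prod.reindex_bij_betw [OF b, of "\<lambda>j. fourier (\<lambda>y. int (\<psi> y)) (x j)"] by simp
qed

text \<open>Indistinguishability accumulates over all smaller decks, so minimality of
  \<open>k\<close> makes every earlier deck agree and the failure can only occur in the
  \<open>k\<close>-deck itself.\<close>

lemma has_distinguishing_number_deck:
  assumes "has_distinguishing_number \<phi> \<psi> k"
  shows "deck k \<phi> \<noteq> deck k \<psi>" and "i < k \<Longrightarrow> deck i \<phi> = deck i \<psi>"
proof -
  show less: "deck i \<phi> = deck i \<psi>" if "i < k" for i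
    using assms that by (meson has_distinguishing_number_def indistinguishable_def le_refl not_le)
  show "deck k \<phi> \<noteq> deck k \<psi>"
    using assms less by (metis has_distinguishing_number_def indistinguishable_def le_neq_implies_less)
qed

section \<open>Linear changes of coordinates\<close>

lemma fourier_push_forward:
  fixes f :: "bit ^ 'm \<Rightarrow> nat" and \<theta> :: "bit ^ 'm \<Rightarrow> bit ^ 'n"
  assumes "\<And>z. character e (\<theta> z) = character x z"
  shows "fourier (\<lambda>y. int (push_forward \<theta> f y)) e = fourier (\<lambda>y. int (f y)) x"
proof -
  have "fourier (\<lambda>y. int (push_forward \<theta> f y)) e
      = (\<Sum>y\<in>UNIV. \<Sum>z | z \<in> UNIV \<and> \<theta> z = y. int (f z) * character e (\<theta> z))"
    by (simp add: fourier_eq_sum_character push_forward_def sum_distrib_right)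
  \<comment> \<open>The fibres of \<open>\<theta>\<close> partition the domain.\<close>
  also have "\<dots> = (\<Sum>z\<in>UNIV. int (f z) * character e (\<theta> z))"
    by (rule sum.group) auto
  finally show ?thesis by (simp add: assms fourier_eq_sum_character)
qed

text \<open>Over the field with two elements linear combinations are subset sums, so
  \<open>indep\<close> is linear independence. As many independent vectors as coordinates span the
  space; hence the signs recorded by \<open>\<theta> z\<close> determine every character at
  \<open>z\<close>, and thus \<open>z\<close>.\<close>

lemma bij_character_coordinates:
  fixes X :: "'n::finite \<Rightarrow> bit ^ 'n" and \<theta> :: "bit ^ 'n \<Rightarrow> bit ^ 'n"
  assumes indep: "\<And>S. (\<Sum>i\<in>S. X i) = 0 \<Longrightarrow> S = {}"
    and coord: "\<And>z i. \<theta> z $ i = (if character (X i) z = 1 then 0 else 1)"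
  shows "bij \<theta>"
proof -
  have inj: "inj (\<lambda>c :: bit ^ 'n. \<Sum>i\<in>UNIV. c $ i *s X i)"
  proof (rule injI)
    fix c d :: "bit ^ 'n"
    assume "(\<Sum>i\<in>UNIV. c $ i *s X i) = (\<Sum>i\<in>UNIV. d $ i *s X i)"
    then have "(\<Sum>i\<in>UNIV. (c + d) $ i *s X i) = 0"
      by (simp only: vector_add_component vector_sadd_rdistrib sum.distrib vec_bit_add_self)
    moreover have "(\<Sum>i\<in>UNIV. (c + d) $ i *s X i) = (\<Sum>i | (c + d) $ i = 1. X i)"
      by (rule sum.mono_neutral_cong_right) auto
    ultimately have "{i. (c + d) $ i = 1} = {}" using indep by metis
    then have "c + d = 0" by (auto simp: vec_eq_iff)
    then show "c = d" by (rule vec_bit_eq_iff_add [THEN iffD2])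
  qed
  then have surj: "surj (\<lambda>c :: bit ^ 'n. \<Sum>i\<in>UNIV. c $ i *s X i)"
    by (simp add: finite_UNIV_inj_surj)
  have "inj \<theta>"
  proof (rule injI)
    fix z w
    assume eq: "\<theta> z = \<theta> w"
    have "character (X i) z = character (X i) w" for i
    proof -
      have "(character (X i) z = 1) = (character (X i) w = 1)"
        using coord [of z i] coord [of w i] eq by (auto split: if_splits)
      then show ?thesis
        using character_cases [of "X i" z] character_cases [of "X i" w] by auto
    qed
    then have "character (c $ i *s X i) z = character (c $ i *s X i) w" for c :: "bit ^ 'n" and i
      by (cases "c $ i") auto
    then have "character (\<Sum>i\<in>UNIV. c $ i *s X i) z = character (\<Sum>i\<in>UNIV. c $ i *s X i) w"
      for c :: "bit ^ 'n"
      by (simp add: character_sum_left)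
    then have same: "character v z = character v w" for v
      using surjD [OF surj, of v] by auto
    \<comment> \<open>Characters of axis vectors read off single coordinates.\<close>
    have "z $ i = w $ i" for i
      using same [of "axis i 1"] by (cases "z $ i"; cases "w $ i") (simp_all add: character_axis)
    then show "z = w" by (simp add: vec_eq_iff)
  qed
  then show ?thesis by (simp add: bij_def finite_UNIV_inj_surj)
qed

lemma ex_bij_additive_character:
  fixes X :: "'n::finite \<Rightarrow> bit ^ 'n"
  assumes "\<And>S. (\<Sum>i\<in>S. X i) = 0 \<Longrightarrow> S = {}"
  obtains \<theta> :: "bit ^ 'n \<Rightarrow> bit ^ 'n" where "bij \<theta>" "Modules.additive \<theta>"
    "\<And>i z. character (axis i 1) (\<theta> z) = character (X i) z"
proof -
  define \<theta> :: "bit ^ 'n \<Rightarrow> bit ^ 'n"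
    where "\<theta> z = (\<chi> i. if character (X i) z = 1 then 0 else 1)" for z
  have coord: "\<theta> z $ i = (if character (X i) z = 1 then 0 else 1)" for z i
    by (simp add: \<theta>_def)
  show ?thesis
  proof
    show "bij \<theta>" using assms coord by (rule bij_character_coordinates)
    show "Modules.additive \<theta>"
    proof
      fix z w
      \<comment> \<open>Encoding the signs 1 and -1 as the bits 0 and 1 turns products into
        sums.\<close>
      have "\<theta> (z + w) $ i = \<theta> z $ i + \<theta> w $ i" for i
        using character_cases [of "X i" z] character_cases [of "X i" w] by (auto simp: coord character_add_right)
      then show "\<theta> (z + w) = \<theta> z + \<theta> w" by (simp add: vec_eq_iff)
    qed
    show "character (axis i 1) (\<theta> z) = character (X i) z" for i z
      using character_cases [of "X i" z] by (auto simp: character_axis coord)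
  qed
qed

section \<open>Minimality and the standard position\<close>

lemma proper_subfamily_sum_nonzero:
  fixes \<phi> \<psi> :: "bit ^ 'n \<Rightarrow> nat"
  assumes decks: "\<And>i. i < k \<Longrightarrow> deck i \<phi> = deck i \<psi>"
    and sum0: "(\<Sum>j=1..k. x j) = 0"
    and neq: "(\<Prod>j=1..k. fourier (\<lambda>y. int (\<phi> y)) (x j)) \<noteq> (\<Prod>j=1..k. fourier (\<lambda>y. int (\<psi> y)) (x j))"
    and S: "S \<subset> {1..k}" "S \<noteq> {}"
  shows "(\<Sum>j\<in>S. x j) \<noteq> 0"
proof
  assume S0: "(\<Sum>j\<in>S. x j) = 0"
  have fin: "finite S" and sub: "S \<subseteq> {1..k}" using S finite_subset by auto
  have T0: "(\<Sum>j\<in>{1..k} - S. x j) = 0"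
    using sum.subset_diff [OF sub, of x] sum0 S0 by simp
  \<comment> \<open>Properness of \<open>S\<close> bounds the first cardinality, nonemptiness the
    second.\<close>
  have "card S < k" "card ({1..k} - S) < k"
    using psubset_card_mono [OF _ S(1)] psubset_card_mono [of "{1..k}" "{1..k} - S"] S sub by auto
  then have "(\<Prod>j\<in>T. fourier (\<lambda>y. int (\<phi> y)) (x j)) = (\<Prod>j\<in>T. fourier (\<lambda>y. int (\<psi> y)) (x j))"
    if "T = S \<or> T = {1..k} - S" for T
    using that fin S0 T0 by (intro deck_eq_imp_prod_fourier_eq decks) auto
  then show False
    using neq unfolding prod.subset_diff [OF sub finite_atLeastAtMost] by simp
qed

theorem theorem4p3:
  fixes f1 f2 :: "bit ^ 'n \<Rightarrow> nat" and k :: nat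
  assumes "k \<ge> 3"
    and "CARD('n) = k - 1"
    and "has_distinguishing_number f1 f2 k"
  shows "\<exists>\<theta> :: bit ^ 'n \<Rightarrow> bit ^ 'n. bij \<theta> \<and> Modules.additive \<theta> \<and>
           standard_position (push_forward \<theta> f1) (push_forward \<theta> f2)"
proof -
  have k: "{1..k} = insert k {1..k - 1}" "k \<notin> {1..k - 1}" using assms(1) by auto
  obtain x where sum0: "(\<Sum>j=1..k. x j) = 0"
    and neq: "(\<Prod>j=1..k. fourier (\<lambda>y. int (f1 y)) (x j)) \<noteq> (\<Prod>j=1..k. fourier (\<lambda>y. int (f2 y)) (x j))"
    using has_distinguishing_number_deck(1) [OF assms(3)] unfolding deck_eq_iff_fourier by blast
  note nonzero = proper_subfamily_sum_nonzero
    [OF has_distinguishing_number_deck(2) [OF assms(3)] sum0 neq]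
  \<comment> \<open>The coordinates are matched with the first \<open>k - 1\<close> indices; index
    \<open>k\<close> is kept for \<open>all_ones\<close>.\<close>
  obtain b :: "'n \<Rightarrow> nat" where b: "bij_betw b UNIV {1..k - 1}"
    using finite_same_card_bij [of "UNIV :: 'n set" "{1..k - 1}"] assms(2) by auto
  have indep: "S = {}" if "(\<Sum>i\<in>S. x (b i)) = 0" for S
  proof (rule ccontr)
    assume "S \<noteq> {}"
    have "inj_on b S" and "b ` S \<subseteq> {1..k - 1}"
      using b by (auto simp: bij_betw_def intro: inj_on_subset)
    \<comment> \<open>The inclusion is strict even for \<open>S = UNIV\<close>, since
      \<open>k\<close> is never hit.\<close>
    then have "b ` S \<subset> {1..k}" using k by blast
    moreover have "(\<Sum>j\<in>b ` S. x j) = 0"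
      using that sum.reindex [OF \<open>inj_on b S\<close>, of x] by simp
    ultimately show False using nonzero \<open>S \<noteq> {}\<close> by blast
  qed
  obtain \<theta> :: "bit ^ 'n \<Rightarrow> bit ^ 'n" where \<theta>: "bij \<theta>" "Modules.additive \<theta>"
    and \<theta>_axis: "\<And>i z. character (axis i 1) (\<theta> z) = character (x (b i)) z"
    using ex_bij_additive_character [of "\<lambda>i. x (b i)"] indep by blast
  have "(\<Sum>i\<in>UNIV. x (b i)) + x k = 0"
    using sum0 sum.reindex_bij_betw [OF b, of x] k by (simp add: add.commute)
  \<comment> \<open>In characteristic 2 the last vector equals the sum of the others, just as
    \<open>all_ones\<close> is the sum of the axis vectors.\<close>
  then have xk: "x k = (\<Sum>i\<in>UNIV. x (b i))" by (metis vec_bit_eq_iff_add)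
  have \<theta>_ones: "character all_ones (\<theta> z) = character (x k) z" for z
    by (simp add: xk all_ones_def character_sum_left \<theta>_axis)
  have "(\<Prod>i\<in>UNIV. fourier (\<lambda>y. int (push_forward \<theta> f y)) (axis i 1))
          * fourier (\<lambda>y. int (push_forward \<theta> f y)) all_ones
      = (\<Prod>j=1..k. fourier (\<lambda>y. int (f y)) (x j))" for f :: "bit ^ 'n \<Rightarrow> nat"
    using prod.reindex_bij_betw [OF b, of "\<lambda>j. fourier (\<lambda>y. int (f y)) (x j)"] k
    by (simp add: fourier_push_forward [OF \<theta>_axis] fourier_push_forward [OF \<theta>_ones] mult.commute)
  then have "standard_position (push_forward \<theta> f1) (push_forward \<theta> f2)"
    using neq by (simp add: standard_position_def)
  with \<theta> show ?thesis by blast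
qed

end
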